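(* Let $K$ be a field, $S=K[x_1,\ldots,x_n]$, and let $I\subset S$ be a squarefree strongly stable principal ideal. Then $I$ satisfies the persistence property: for every prime ideal $P\subset S$ and every integer $k\ge 1$, if $P\in\operatorname{Ass}(I^k)$ then $P\in \operatorname{Ass}(I^{k+1})$.
   Context: For an ideal $J\subset S$, $\operatorname{Ass}(J)$ denotes the set of associated prime ideals of the $S$-module $S/J$. For a monomial ideal $I$, $G(I)$ denotes its unique minimal set of monomial generators. A monomial ideal $I\subset S$ generated in a single degree is squarefree strongly stable if all $u\in G(I)$ are squarefree and, for every $u\in G(I)$ and all $1\le i<j\le n$ such that $x_j\mid u$ and $x_i\nmid u$, one has $x_i(u/x_j)\in G(I)$. It is a squarefree strongly stable principal ideal (also called squarefree principal Borel ideal) if there is a squarefree monomial $u\in G(I)$ (the Borel generator) such that $I$ is the smallest squarefree strongly stable ideal containing $u$. Explicitly, if $u=x_{i_1}\cdots x_{i_d}$ with $1\le i_1<\cdots<i_d\le n$, then $G(I)=\{x_{j_1}\cdots x_{j_d} : 1\le j_1<\cdots<j_d\le n,\ j_k\le i_k \text{ for } 1\le k\le d\}$. *)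

theory Defs
  imports
    "HOL-Library.Poly_Mapping"
    "HOL-Algebra.Module"
    "HOL-Algebra.QuotRing"
    "HOL-Algebra.Ideal_Product"
begin

section \<open>The polynomial ring \<open>K[x\<^sub>1, \<dots>, x\<^sub>n]\<close>\<close>

text \<open>A monomial is represented by its exponent vector, a finitely supported function on the
  variable indices; the type \<open>(nat \<Rightarrow>\<^sub>0 nat) \<Rightarrow>\<^sub>0 'k\<close> is then the polynomial ring in
  countably many variables with the convolution product, of which \<open>K[x\<^sub>1, \<dots>, x\<^sub>n]\<close> is
  a subring.\<close>

definition monomials :: "nat \<Rightarrow> (nat \<Rightarrow>\<^sub>0 nat) set" where
  "monomials n = {u. Poly_Mapping.keys u \<subseteq> {1..n}}"

definition poly_ring :: "nat \<Rightarrow> ((nat \<Rightarrow>\<^sub>0 nat) \<Rightarrow>\<^sub>0 'k::field) ring" where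
  "poly_ring n =
    \<lparr>carrier = {p. Poly_Mapping.keys p \<subseteq> monomials n},
     mult = (*), one = 1, zero = 0, add = (+)\<rparr>"

definition mon :: "(nat \<Rightarrow>\<^sub>0 nat) \<Rightarrow> (nat \<Rightarrow>\<^sub>0 nat) \<Rightarrow>\<^sub>0 'k::field" where
  "mon u = Poly_Mapping.single u 1"

abbreviation var :: "nat \<Rightarrow> (nat \<Rightarrow>\<^sub>0 nat)" where
  "var i \<equiv> Poly_Mapping.single i 1"

definition mon_deg :: "(nat \<Rightarrow>\<^sub>0 nat) \<Rightarrow> nat" where
  "mon_deg u = (\<Sum>i\<in>Poly_Mapping.keys u. Poly_Mapping.lookup u i)"

definition squarefree_mon :: "(nat \<Rightarrow>\<^sub>0 nat) \<Rightarrow> bool" where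
  "squarefree_mon u \<longleftrightarrow> (\<forall>i. Poly_Mapping.lookup u i \<le> 1)"


section \<open>Associated primes\<close>

definition annihilator :: "('a, 'm) ring_scheme \<Rightarrow> ('a, 'b, 'c) module_scheme \<Rightarrow> 'b \<Rightarrow> 'a set" where
  "annihilator R M x = {r \<in> carrier R. r \<odot>\<^bsub>M\<^esub> x = \<zero>\<^bsub>M\<^esub>}"

definition module_Ass :: "('a, 'm) ring_scheme \<Rightarrow> ('a, 'b, 'c) module_scheme \<Rightarrow> 'a set set" where
  "module_Ass R M = {P. primeideal P R \<and> (\<exists>x\<in>carrier M. P = annihilator R M x)}"

definition quot_module :: "('a, 'm) ring_scheme \<Rightarrow> 'a set \<Rightarrow> ('a, 'a set) module" where
  "quot_module R J =
    \<lparr>carrier = carrier (R Quot J), mult = mult (R Quot J), one = one (R Quot J),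
     zero = zero (R Quot J), add = add (R Quot J),
     smult = (\<lambda>r X. (J +>\<^bsub>R\<^esub> r) \<otimes>\<^bsub>R Quot J\<^esub> X)\<rparr>"

definition Ass :: "('a, 'm) ring_scheme \<Rightarrow> 'a set \<Rightarrow> 'a set set" where
  "Ass R J = module_Ass R (quot_module R J)"

definition ideal_power :: "('a, 'm) ring_scheme \<Rightarrow> 'a set \<Rightarrow> nat \<Rightarrow> 'a set" where
  "ideal_power R I k = I [^]\<^bsub>ideals_set R\<^esub> k"


section \<open>Monomial ideals\<close>

definition monomial_ideal :: "nat \<Rightarrow> ((nat \<Rightarrow>\<^sub>0 nat) \<Rightarrow>\<^sub>0 'k::field) set \<Rightarrow> bool" where
  "monomial_ideal n I \<longleftrightarrow> (\<exists>M \<subseteq> monomials n. I = Idl\<^bsub>poly_ring n\<^esub> (mon ` M))"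

definition is_min_mon_gens ::
    "nat \<Rightarrow> ((nat \<Rightarrow>\<^sub>0 nat) \<Rightarrow>\<^sub>0 'k::field) set \<Rightarrow> (nat \<Rightarrow>\<^sub>0 nat) set \<Rightarrow> bool" where
  "is_min_mon_gens n I G \<longleftrightarrow>
     G \<subseteq> monomials n \<and> I = Idl\<^bsub>poly_ring n\<^esub> (mon ` G) \<and>
     (\<forall>H. H \<subset> G \<longrightarrow> I \<noteq> Idl\<^bsub>poly_ring n\<^esub> (mon ` H))"

text \<open>\<open>G(I)\<close>, as a set of exponent vectors. It is meaningful only for monomial ideals; see
  \<open>ex1_min_mon_gens\<close> below.\<close>

definition min_mon_gens ::
    "nat \<Rightarrow> ((nat \<Rightarrow>\<^sub>0 nat) \<Rightarrow>\<^sub>0 'k::field) set \<Rightarrow> (nat \<Rightarrow>\<^sub>0 nat) set" where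
  "min_mon_gens n I = (THE G. is_min_mon_gens n I G)"

text \<open>For \<open>x\<^sub>j \<bar> u\<close>, the exponent vector of \<open>x\<^sub>i(u/x\<^sub>j)\<close> is \<open>var i + (u - var j)\<close>.\<close>

definition squarefree_strongly_stable ::
    "nat \<Rightarrow> ((nat \<Rightarrow>\<^sub>0 nat) \<Rightarrow>\<^sub>0 'k::field) set \<Rightarrow> bool" where
  "squarefree_strongly_stable n I \<longleftrightarrow>
     monomial_ideal n I \<and>
     (\<exists>d. \<forall>u\<in>min_mon_gens n I. mon_deg u = d) \<and>
     (\<forall>u\<in>min_mon_gens n I. squarefree_mon u) \<and>
     (\<forall>u\<in>min_mon_gens n I. \<forall>i j. 1 \<le> i \<and> i < j \<and> j \<le> n \<and>
        j \<in> Poly_Mapping.keys u \<and> i \<notin> Poly_Mapping.keys u \<longrightarrow>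
        var i + (u - var j) \<in> min_mon_gens n I)"

definition squarefree_strongly_stable_principal ::
    "nat \<Rightarrow> ((nat \<Rightarrow>\<^sub>0 nat) \<Rightarrow>\<^sub>0 'k::field) set \<Rightarrow> bool" where
  "squarefree_strongly_stable_principal n I \<longleftrightarrow>
     squarefree_strongly_stable n I \<and>
     (\<exists>u\<in>min_mon_gens n I. squarefree_mon u \<and>
        (\<forall>J. squarefree_strongly_stable n J \<and> mon u \<in> J \<longrightarrow> I \<subseteq> J))"


section \<open>Well-definedness\<close>

lemma monomials_0: "0 \<in> monomials n"
  by (simp add: monomials_def)

lemma monomials_add: "u \<in> monomials n \<Longrightarrow> v \<in> monomials n \<Longrightarrow> u + v \<in> monomials n"
  using Poly_Mapping.keys_add[of u v] by (auto simp: monomials_def)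

lemma poly_ring_mult_closed:
  fixes p q :: "(nat \<Rightarrow>\<^sub>0 nat) \<Rightarrow>\<^sub>0 'k::field"
  assumes "Poly_Mapping.keys p \<subseteq> monomials n" "Poly_Mapping.keys q \<subseteq> monomials n"
  shows "Poly_Mapping.keys (p * q) \<subseteq> monomials n"
proof
  fix t assume "t \<in> Poly_Mapping.keys (p * q)"
  then obtain a b where "a \<in> Poly_Mapping.keys p" "b \<in> Poly_Mapping.keys q" "t = a + b"
    using keys_mult[of p q] by blast
  then show "t \<in> monomials n" using assms monomials_add by blast
qed

lemma cring_poly_ring: "cring (poly_ring n :: ((nat \<Rightarrow>\<^sub>0 nat) \<Rightarrow>\<^sub>0 'k::field) ring)"
proof (rule cringI)
  show "abelian_group (poly_ring n :: ((nat \<Rightarrow>\<^sub>0 nat) \<Rightarrow>\<^sub>0 'k) ring)"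
  proof (rule abelian_groupI)
    fix x y :: "(nat \<Rightarrow>\<^sub>0 nat) \<Rightarrow>\<^sub>0 'k"
    assume "x \<in> carrier (poly_ring n)" "y \<in> carrier (poly_ring n)"
    then show "x \<oplus>\<^bsub>poly_ring n\<^esub> y \<in> carrier (poly_ring n)"
      using Poly_Mapping.keys_add[of x y] by (auto simp: poly_ring_def)
  next
    fix x :: "(nat \<Rightarrow>\<^sub>0 nat) \<Rightarrow>\<^sub>0 'k"
    assume "x \<in> carrier (poly_ring n)"
    then show "\<exists>y\<in>carrier (poly_ring n). y \<oplus>\<^bsub>poly_ring n\<^esub> x = \<zero>\<^bsub>poly_ring n\<^esub>"
      by (intro bexI[of _ "- x"]) (auto simp: poly_ring_def)
  qed (auto simp: poly_ring_def add_ac)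
  show "Group.comm_monoid (poly_ring n :: ((nat \<Rightarrow>\<^sub>0 nat) \<Rightarrow>\<^sub>0 'k) ring)"
  proof (rule comm_monoidI)
    fix x y :: "(nat \<Rightarrow>\<^sub>0 nat) \<Rightarrow>\<^sub>0 'k"
    assume "x \<in> carrier (poly_ring n)" "y \<in> carrier (poly_ring n)"
    then show "x \<otimes>\<^bsub>poly_ring n\<^esub> y \<in> carrier (poly_ring n)"
      using poly_ring_mult_closed[of x n y] by (simp add: poly_ring_def)
  qed (auto simp: poly_ring_def mult_ac monomials_0)
qed (simp add: poly_ring_def distrib_right)

lemma module_quot_module:
  assumes "cring R" "ideal J R"
  shows "module R (quot_module R J)"
proof -
  interpret R: cring R by fact
  interpret J: ideal J R by fact
  interpret Q: cring "R Quot J" by (rule J.quotient_is_cring) fact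
  interpret h: ring_hom_ring R "R Quot J" "(+>\<^bsub>R\<^esub>) J" by (rule J.rcos_ring_hom_ring)
  have ag: "abelian_group (quot_module R J)"
  proof (rule abelian_groupI)
    fix x assume "x \<in> carrier (quot_module R J)"
    then have "\<ominus>\<^bsub>R Quot J\<^esub> x \<in> carrier (quot_module R J)"
        "\<ominus>\<^bsub>R Quot J\<^esub> x \<oplus>\<^bsub>quot_module R J\<^esub> x = \<zero>\<^bsub>quot_module R J\<^esub>"
      by (auto simp: quot_module_def Q.l_neg)
    then show "\<exists>y\<in>carrier (quot_module R J). y \<oplus>\<^bsub>quot_module R J\<^esub> x = \<zero>\<^bsub>quot_module R J\<^esub>"
      by blast
  qed (simp_all add: quot_module_def Q.a_ac)
  show ?thesis
  proof (rule moduleI[OF assms(1) ag])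
    fix x assume "x \<in> carrier (quot_module R J)"
    then show "\<one>\<^bsub>R\<^esub> \<odot>\<^bsub>quot_module R J\<^esub> x = x"
      using h.hom_one by (simp add: quot_module_def)
  qed (auto simp: quot_module_def Q.l_distr Q.r_distr Q.m_assoc)
qed

lemma Idl_mon:
  fixes n :: nat
  assumes M: "M \<subseteq> monomials n"
  shows "Idl\<^bsub>poly_ring n\<^esub> (mon ` M) =
    {p :: (nat \<Rightarrow>\<^sub>0 nat) \<Rightarrow>\<^sub>0 'k::field.
      Poly_Mapping.keys p \<subseteq> monomials n \<and>
      (\<forall>t\<in>Poly_Mapping.keys p. \<exists>g\<in>M. \<exists>s\<in>monomials n. t = s + g)}"
    (is "Idl\<^bsub>?R\<^esub> _ = ?A")
proof
  interpret R: cring ?R by (rule cring_poly_ring)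
  have carr: "carrier ?R = {p. Poly_Mapping.keys p \<subseteq> monomials n}"
    by (simp add: poly_ring_def)
  have mult: "r * p \<in> ?A" if r: "r \<in> carrier ?R" and p: "p \<in> ?A" for r p
  proof -
    have "\<exists>g\<in>M. \<exists>s\<in>monomials n. t = s + g" if t: "t \<in> Poly_Mapping.keys (r * p)" for t
    proof -
      from t obtain a b where ab: "a \<in> Poly_Mapping.keys r" "b \<in> Poly_Mapping.keys p" "t = a + b"
        using keys_mult[of r p] by blast
      from p ab(2) obtain g s where gs: "g \<in> M" "s \<in> monomials n" "b = s + g" by auto
      have "a + s \<in> monomials n" using r ab(1) gs(2) by (auto simp: carr intro: monomials_add)
      moreover have "t = (a + s) + g" using ab gs by (simp add: add.assoc)
      ultimately show ?thesis using gs(1) by blast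
    qed
    moreover have "Poly_Mapping.keys (r * p) \<subseteq> monomials n"
      using r p by (intro poly_ring_mult_closed) (auto simp: carr)
    ultimately show ?thesis by blast
  qed
  have idA: "ideal ?A ?R"
  proof (rule idealI)
    show "ring ?R" by (rule R.ring_axioms)
    show "subgroup ?A (add_monoid ?R)"
    proof (rule R.add.subgroupI)
      show "?A \<subseteq> carrier ?R" by (auto simp: carr)
      show "?A \<noteq> {}" by (intro ex_in_conv[THEN iffD1] exI[of _ 0]) simp
    next
      fix p assume p: "p \<in> ?A"
      have "- p \<in> ?A" using p by simp
      moreover have "\<ominus>\<^bsub>?R\<^esub> p = - p"
        using p by (intro R.minus_equality) (auto simp: poly_ring_def)
      ultimately show "\<ominus>\<^bsub>?R\<^esub> p \<in> ?A" by simp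
    next
      fix p q assume "p \<in> ?A" "q \<in> ?A"
      then show "p \<oplus>\<^bsub>?R\<^esub> q \<in> ?A"
        using Poly_Mapping.keys_add[of p q] by (simp add: poly_ring_def) blast
    qed
    fix p r assume pr: "p \<in> ?A" "r \<in> carrier ?R"
    show "r \<otimes>\<^bsub>?R\<^esub> p \<in> ?A" using mult[OF pr(2,1)] by (simp add: poly_ring_def)
    show "p \<otimes>\<^bsub>?R\<^esub> r \<in> ?A" using mult[OF pr(2,1)] by (simp add: poly_ring_def mult.commute)
  qed
  have "mon ` M \<subseteq> ?A"
  proof
    fix p :: "(nat \<Rightarrow>\<^sub>0 nat) \<Rightarrow>\<^sub>0 'k" assume "p \<in> mon ` M"
    then obtain g where g: "g \<in> M" "p = mon g" by blast
    then have "\<exists>h\<in>M. \<exists>s\<in>monomials n. g = s + h"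
      using monomials_0[of n] by (intro bexI[of _ g] bexI[of _ 0]) auto
    then show "p \<in> ?A" using g M by (auto simp: mon_def)
  qed
  then show "Idl\<^bsub>?R\<^esub> (mon ` M) \<subseteq> ?A" using idA by (intro R.genideal_minimal)
  show "?A \<subseteq> Idl\<^bsub>?R\<^esub> (mon ` M)"
  proof
    fix p assume p: "p \<in> ?A"
    have MC: "(mon ` M :: ((nat \<Rightarrow>\<^sub>0 nat) \<Rightarrow>\<^sub>0 'k) set) \<subseteq> carrier ?R"
      using M by (auto simp: carr mon_def)
    interpret D: ideal "Idl\<^bsub>?R\<^esub> (mon ` M)" ?R using MC by (rule R.genideal_ideal)
    have trm: "Poly_Mapping.single t (Poly_Mapping.lookup p t) \<in> Idl\<^bsub>?R\<^esub> (mon ` M)"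
      if t: "t \<in> Poly_Mapping.keys p" for t
    proof -
      from p t obtain g s where gs: "g \<in> M" "s \<in> monomials n" "t = s + g" by auto
      have "Poly_Mapping.single s (Poly_Mapping.lookup p t) \<in> carrier ?R"
        using gs(2) by (auto simp: carr)
      moreover have "mon g \<in> Idl\<^bsub>?R\<^esub> (mon ` M :: ((nat \<Rightarrow>\<^sub>0 nat) \<Rightarrow>\<^sub>0 'k) set)"
        using R.genideal_self[OF MC] gs(1) by blast
      ultimately have "Poly_Mapping.single s (Poly_Mapping.lookup p t) \<otimes>\<^bsub>?R\<^esub> mon g \<in> Idl\<^bsub>?R\<^esub> (mon ` M)"
        by (rule D.I_l_closed[rotated])
      then show ?thesis using gs(3) by (simp add: poly_ring_def mon_def mult_single)
    qed
    have "(\<Sum>t\<in>F. Poly_Mapping.single t (Poly_Mapping.lookup p t)) \<in> Idl\<^bsub>?R\<^esub> (mon ` M)"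
      if "finite F" "F \<subseteq> Poly_Mapping.keys p" for F
      using that
    proof (induction F rule: finite_induct)
      case empty
      show ?case using D.zero_closed by (simp add: poly_ring_def)
    next
      case (insert t F)
      then have "Poly_Mapping.single t (Poly_Mapping.lookup p t) \<oplus>\<^bsub>?R\<^esub>
          (\<Sum>t\<in>F. Poly_Mapping.single t (Poly_Mapping.lookup p t)) \<in> Idl\<^bsub>?R\<^esub> (mon ` M)"
        by (intro D.a_closed trm) auto
      then show ?case using insert by (simp add: poly_ring_def)
    qed
    moreover have "(\<Sum>t\<in>Poly_Mapping.keys p. Poly_Mapping.single t (Poly_Mapping.lookup p t)) = p"
      by (rule poly_mapping_eqI)
        (auto simp: lookup_sum lookup_single when_def in_keys_iff sum.delta)
    ultimately show "p \<in> Idl\<^bsub>?R\<^esub> (mon ` M)"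
      by (metis finite_keys order_refl)
  qed
qed

lemma mon_in_Idl_mon_iff:
  assumes "M \<subseteq> monomials n" "u \<in> monomials n"
  shows "(mon u :: (nat \<Rightarrow>\<^sub>0 nat) \<Rightarrow>\<^sub>0 'k::field) \<in> Idl\<^bsub>poly_ring n\<^esub> (mon ` M) \<longleftrightarrow>
    (\<exists>g\<in>M. \<exists>s\<in>monomials n. u = s + g)"
  unfolding Idl_mon[OF assms(1)] using assms(2) by (simp add: mon_def)

lemma Idl_mon_subset:
  assumes "M \<subseteq> monomials n" "N \<subseteq> monomials n"
    and "\<And>u. u \<in> M \<Longrightarrow> \<exists>g\<in>N. \<exists>s\<in>monomials n. u = s + g"
  shows "Idl\<^bsub>poly_ring n\<^esub> (mon ` M :: ((nat \<Rightarrow>\<^sub>0 nat) \<Rightarrow>\<^sub>0 'k::field) set) \<subseteq> Idl\<^bsub>poly_ring n\<^esub> (mon ` N)"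
proof -
  interpret R: cring "poly_ring n :: ((nat \<Rightarrow>\<^sub>0 nat) \<Rightarrow>\<^sub>0 'k) ring" by (rule cring_poly_ring)
  have "(mon ` N :: ((nat \<Rightarrow>\<^sub>0 nat) \<Rightarrow>\<^sub>0 'k) set) \<subseteq> carrier (poly_ring n)"
    using assms(2) by (auto simp: poly_ring_def mon_def)
  then have "ideal (Idl\<^bsub>poly_ring n\<^esub> (mon ` N :: ((nat \<Rightarrow>\<^sub>0 nat) \<Rightarrow>\<^sub>0 'k) set)) (poly_ring n)"
    by (rule R.genideal_ideal)
  moreover have "(mon ` M :: ((nat \<Rightarrow>\<^sub>0 nat) \<Rightarrow>\<^sub>0 'k) set) \<subseteq> Idl\<^bsub>poly_ring n\<^esub> (mon ` N)"
    using assms by (auto simp: mon_in_Idl_mon_iff subset_iff)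
  ultimately show ?thesis by (rule R.genideal_minimal)
qed

lemma mon_deg_eq:
  assumes "u \<in> monomials n"
  shows "mon_deg u = (\<Sum>i\<in>{1..n}. Poly_Mapping.lookup u i)"
  using assms unfolding mon_deg_def monomials_def
  by (intro sum.mono_neutral_left) (auto simp: in_keys_iff)

lemma mon_deg_add:
  assumes "u \<in> monomials n" "v \<in> monomials n"
  shows "mon_deg (u + v) = mon_deg u + mon_deg v"
  using assms by (simp add: mon_deg_eq[of _ n] monomials_add lookup_add sum.distrib)

lemma mon_deg_pos:
  assumes "u \<noteq> 0"
  shows "0 < mon_deg u"
proof -
  from assms obtain i where "i \<in> Poly_Mapping.keys u" by (metis equals0I keys_eq_empty)
  then show ?thesis
    unfolding mon_deg_def by (intro sum_pos2[of _ i]) (auto simp: in_keys_iff)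
qed

lemma mon_sum_eq_0:
  fixes s t :: "nat \<Rightarrow>\<^sub>0 nat"
  assumes "s + t = 0"
  shows "s = 0" "t = 0"
proof -
  have "Poly_Mapping.lookup s i + Poly_Mapping.lookup t i = 0" for i
    using assms by (metis lookup_add lookup_zero)
  then show "s = 0" "t = 0" by (auto intro!: poly_mapping_eqI)
qed

lemma ex1_min_mon_gens:
  fixes I :: "((nat \<Rightarrow>\<^sub>0 nat) \<Rightarrow>\<^sub>0 'k::field) set"
  assumes "monomial_ideal n I"
  shows "\<exists>!G. is_min_mon_gens n I G"
proof -
  from assms obtain M where M: "M \<subseteq> monomials n" and I: "I = Idl\<^bsub>poly_ring n\<^esub> (mon ` M)"
    unfolding monomial_ideal_def by blast
  define G where "G = {g \<in> M. \<forall>h\<in>M. \<forall>s\<in>monomials n. g = s + h \<longrightarrow> s = 0}"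
  have GM: "G \<subseteq> M" by (auto simp: G_def)
  have red: "\<exists>g\<in>G. \<exists>s\<in>monomials n. u = s + g" if "u \<in> M" for u
    using that
  proof (induction "mon_deg u" arbitrary: u rule: less_induct)
    case less
    show ?case
    proof (cases "u \<in> G")
      case True
      then show ?thesis using monomials_0[of n] by (intro bexI[of _ u] bexI[of _ 0]) auto
    next
      case False
      then obtain h s where hs: "h \<in> M" "s \<in> monomials n" "u = s + h" "s \<noteq> 0"
        using less.prems unfolding G_def by blast
      then have "mon_deg h < mon_deg u"
        using mon_deg_add[of s n h] M mon_deg_pos[of s] by auto
      from less.hyps[OF this hs(1)] obtain g t where "g \<in> G" "t \<in> monomials n" "h = t + g"
        by blast
      then show ?thesis using hs
        by (intro bexI[of _ g] bexI[of _ "s + t"]) (auto simp: add.assoc intro: monomials_add)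
    qed
  qed
  have "Idl\<^bsub>poly_ring n\<^esub> (mon ` M :: ((nat \<Rightarrow>\<^sub>0 nat) \<Rightarrow>\<^sub>0 'k) set) = Idl\<^bsub>poly_ring n\<^esub> (mon ` G)"
  proof
    show "Idl\<^bsub>poly_ring n\<^esub> (mon ` M :: ((nat \<Rightarrow>\<^sub>0 nat) \<Rightarrow>\<^sub>0 'k) set) \<subseteq> Idl\<^bsub>poly_ring n\<^esub> (mon ` G)"
      using M GM red by (intro Idl_mon_subset) auto
    show "Idl\<^bsub>poly_ring n\<^esub> (mon ` G :: ((nat \<Rightarrow>\<^sub>0 nat) \<Rightarrow>\<^sub>0 'k) set) \<subseteq> Idl\<^bsub>poly_ring n\<^esub> (mon ` M)"
    proof (intro Idl_mon_subset)
      fix u assume "u \<in> G"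
      then show "\<exists>g\<in>M. \<exists>s\<in>monomials n. u = s + g"
        using GM monomials_0[of n] by (intro bexI[of _ u] bexI[of _ 0]) auto
    qed (use M GM in auto)
  qed
  then have IG: "I = Idl\<^bsub>poly_ring n\<^esub> (mon ` G)" using I by simp
  have "I \<noteq> Idl\<^bsub>poly_ring n\<^esub> (mon ` H)" if H: "H \<subset> G" for H
  proof
    assume IH: "I = Idl\<^bsub>poly_ring n\<^esub> (mon ` H)"
    from H obtain g where g: "g \<in> G" "g \<notin> H" by blast
    have gm: "g \<in> monomials n" using g(1) GM M by blast
    have "\<exists>h\<in>G. \<exists>s\<in>monomials n. g = s + h"
      using g(1) monomials_0[of n] by (intro bexI[of _ g] bexI[of _ 0]) auto
    moreover have Gm: "G \<subseteq> monomials n" and Hm: "H \<subseteq> monomials n" using GM M H by auto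
    ultimately have "mon g \<in> I" unfolding IG using mon_in_Idl_mon_iff[OF Gm gm] by blast
    then obtain h s where h: "h \<in> H" "s \<in> monomials n" "g = s + h"
      unfolding IH mon_in_Idl_mon_iff[OF Hm gm] by blast
    moreover have "h \<in> M" using h(1) H GM by blast
    ultimately have "s = 0" using g(1) unfolding G_def by blast
    then show False using h g(2) by simp
  qed
  then have ex: "is_min_mon_gens n I G"
    unfolding is_min_mon_gens_def using GM M IG by blast
  have sub: "A \<subseteq> B" if A: "is_min_mon_gens n I A" and B: "is_min_mon_gens n I B" for A B
  proof
    fix g assume g: "g \<in> A"
    have Am: "A \<subseteq> monomials n" and IA: "I = Idl\<^bsub>poly_ring n\<^esub> (mon ` A)"
      and Amin: "\<And>H. H \<subset> A \<Longrightarrow> I \<noteq> Idl\<^bsub>poly_ring n\<^esub> (mon ` H)"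
      and Bm: "B \<subseteq> monomials n" and IB: "I = Idl\<^bsub>poly_ring n\<^esub> (mon ` B)"
      using A B unfolding is_min_mon_gens_def by blast+
    have self: "mon u \<in> Idl\<^bsub>poly_ring n\<^esub> (mon ` C :: ((nat \<Rightarrow>\<^sub>0 nat) \<Rightarrow>\<^sub>0 'k) set)"
      if "C \<subseteq> monomials n" "u \<in> C" for u C
    proof -
      have "\<exists>g\<in>C. \<exists>s\<in>monomials n. u = s + g"
        using that monomials_0[of n] by (intro bexI[of _ u] bexI[of _ 0]) auto
      then show ?thesis using mon_in_Idl_mon_iff[of C n u] that by blast
    qed
    have gm: "g \<in> monomials n" using g Am by blast
    have "mon g \<in> I" using self[OF Am g] IA by simp
    then have "mon g \<in> Idl\<^bsub>poly_ring n\<^esub> (mon ` B :: ((nat \<Rightarrow>\<^sub>0 nat) \<Rightarrow>\<^sub>0 'k) set)" using IB by simp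
    then obtain b s where b: "b \<in> B" "s \<in> monomials n" "g = s + b"
      unfolding mon_in_Idl_mon_iff[OF Bm gm] by blast
    have bm: "b \<in> monomials n" using b(1) Bm by blast
    have "mon b \<in> I" using self[OF Bm b(1)] IB by simp
    then have "mon b \<in> Idl\<^bsub>poly_ring n\<^esub> (mon ` A :: ((nat \<Rightarrow>\<^sub>0 nat) \<Rightarrow>\<^sub>0 'k) set)" using IA by simp
    then obtain a t where a: "a \<in> A" "t \<in> monomials n" "b = t + a"
      unfolding mon_in_Idl_mon_iff[OF Am bm] by blast
    have ga: "g = (s + t) + a" using a b by (simp add: add.assoc)
    have "a = g"
    proof (rule ccontr)
      assume ne: "a \<noteq> g"
      have "Idl\<^bsub>poly_ring n\<^esub> (mon ` A :: ((nat \<Rightarrow>\<^sub>0 nat) \<Rightarrow>\<^sub>0 'k) set) \<subseteq> Idl\<^bsub>poly_ring n\<^esub> (mon ` (A - {g}))"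
      proof (intro Idl_mon_subset)
        fix u assume u: "u \<in> A"
        show "\<exists>h\<in>A - {g}. \<exists>s\<in>monomials n. u = s + h"
        proof (cases "u = g")
          case True
          then have "u = (s + t) + a" using ga by simp
          moreover have "a \<in> A - {g}" "s + t \<in> monomials n"
            using a b ne by (auto intro: monomials_add)
          ultimately show ?thesis by blast
        next
          case False
          then show ?thesis using u monomials_0[of n]
            by (intro bexI[of _ u] bexI[of _ 0]) auto
        qed
      qed (use Am in auto)
      moreover have "Idl\<^bsub>poly_ring n\<^esub> (mon ` (A - {g}) :: ((nat \<Rightarrow>\<^sub>0 nat) \<Rightarrow>\<^sub>0 'k) set) \<subseteq> Idl\<^bsub>poly_ring n\<^esub> (mon ` A)"
        unfolding genideal_def by blast
      ultimately have "I = Idl\<^bsub>poly_ring n\<^esub> (mon ` (A - {g}))" using IA by simp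
      then show False using Amin[of "A - {g}"] g by blast
    qed
    then have "s + t = 0" using ga by simp
    then have "s = 0" by (rule mon_sum_eq_0)
    then show "g \<in> B" using b by simp
  qed
  show ?thesis
    using ex sub by blast
qed

end

theory Submission
  imports Defs
begin

text \<open>Persistence follows from \<open>I\<^sup>k\<^sup>+\<^sup>1 : I = I\<^sup>k\<close>: if \<open>P = I\<^sup>k : f\<close>, then \<open>P\<close> is the intersection of
  the finitely many ideals \<open>I\<^sup>k\<^sup>+\<^sup>1 : fg\<close>, \<open>g \<in> G(I)\<close>, and being prime it equals one of them.

  For the colon equality, let \<open>U\<close> be the support of the Borel generator. A monomial with exponents
  \<open>v\<^sub>j\<close> lies in \<open>I\<^sup>k\<close> if and only if the sum of \<open>min v\<^sub>j k\<close> over \<open>j < s\<close> is at least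
  \<open>k |U \<inter> [1, s)|\<close> for every \<open>s\<close>: deal out the sorted list of its variables cyclically to \<open>k\<close>
  factors. If such an inequality fails for \<open>v\<close>, then the corresponding inequality for \<open>k + 1\<close> fails
  for the product with a suitable element of \<open>G(I)\<close>.\<close>

section \<open>Persistence from a colon condition\<close>

text \<open>Elements of the quotient module are cosets, and the annihilator of the coset of
  \<open>f\<close> is the colon ideal \<open>J : f\<close>. This removes module language from
  everything that follows.\<close>

lemma Ass_iff:
  assumes "cring R" "ideal J R"
  shows "P \<in> Ass R J \<longleftrightarrow>
    primeideal P R \<and> (\<exists>f\<in>carrier R. P = {r \<in> carrier R. r \<otimes>\<^bsub>R\<^esub> f \<in> J})"
proof -
  interpret R: cring R by fact
  interpret J: ideal J R by fact
  have ann: "annihilator R (quot_module R J) (J +>\<^bsub>R\<^esub> f) = {r \<in> carrier R. r \<otimes>\<^bsub>R\<^esub> f \<in> J}"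
    if "f \<in> carrier R" for f
  proof -
    have "(J +>\<^bsub>R\<^esub> (r \<otimes>\<^bsub>R\<^esub> f) = J) = (r \<otimes>\<^bsub>R\<^esub> f \<in> J)" if "r \<in> carrier R" for r
      using that \<open>f \<in> carrier R\<close> J.a_rcos_const R.a_coset_join1[OF _ _ J.a_subgroup] by auto
    then show ?thesis
      unfolding annihilator_def quot_module_def FactRing_def
      using that by (intro Collect_cong) (simp add: J.rcoset_mult_add cong: conj_cong)
  qed
  have "carrier (quot_module R J) = (\<lambda>f. J +>\<^bsub>R\<^esub> f) ` carrier R"
    by (auto simp: quot_module_def FactRing_def A_RCOSETS_def')
  then show ?thesis
    by (auto simp: Ass_def module_Ass_def ann)
qed

text \<open>Together \<open>mult\<close> and \<open>colon\<close> express \<open>J = J' : F\<close>.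
  Finiteness of \<open>F\<close> is what allows a single \<open>g\<close> to realise the prime
  \<open>P\<close>.\<close>

lemma Ass_persistence_of_colon:
  assumes "cring R" "ideal J R" "ideal J' R" "finite F" "F \<subseteq> carrier R"
    and mult: "\<And>f g. f \<in> J \<Longrightarrow> g \<in> F \<Longrightarrow> f \<otimes>\<^bsub>R\<^esub> g \<in> J'"
    and colon: "\<And>f. f \<in> carrier R \<Longrightarrow> (\<And>g. g \<in> F \<Longrightarrow> f \<otimes>\<^bsub>R\<^esub> g \<in> J') \<Longrightarrow> f \<in> J"
    and P: "P \<in> Ass R J"
  shows "P \<in> Ass R J'"
proof -
  interpret R: cring R by fact
  interpret J': ideal J' R by fact
  from P Ass_iff[OF assms(1,2)] obtain f where
    prime: "primeideal P R" and f: "f \<in> carrier R" and P_eq: "P = {r \<in> carrier R. r \<otimes>\<^bsub>R\<^esub> f \<in> J}"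
    by blast
  interpret P: primeideal P R by fact
  have "\<exists>g\<in>F. {r \<in> carrier R. r \<otimes>\<^bsub>R\<^esub> (f \<otimes>\<^bsub>R\<^esub> g) \<in> J'} \<subseteq> P"
  proof (rule ccontr)
    assume neg: "\<not> ?thesis"
    \<comment> \<open>If every \<open>g\<close> admits a multiplier outside \<open>P\<close>, the
      product of these multipliers stays outside the prime \<open>P\<close> and serves all of
      \<open>F'\<close> at once. Properness of \<open>P\<close> starts the induction.\<close>
    have "\<exists>r\<in>carrier R - P. \<forall>g\<in>F'. r \<otimes>\<^bsub>R\<^esub> (f \<otimes>\<^bsub>R\<^esub> g) \<in> J'" if "F' \<subseteq> F" for F'
      using finite_subset[OF that \<open>finite F\<close>] that
    proof (induction F' rule: finite_induct)
      case empty
      have "\<exists>r. r \<in> carrier R \<and> r \<notin> P" using P.I_notcarr P.a_subset by blast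
      then show ?case by blast
    next
      case (insert g F')
      then obtain r where r: "r \<in> carrier R" "r \<notin> P" "\<And>h. h \<in> F' \<Longrightarrow> r \<otimes>\<^bsub>R\<^esub> (f \<otimes>\<^bsub>R\<^esub> h) \<in> J'"
        by blast
      from neg insert.prems obtain s where
        s: "s \<in> carrier R" "s \<notin> P" "s \<otimes>\<^bsub>R\<^esub> (f \<otimes>\<^bsub>R\<^esub> g) \<in> J'" by blast
      have F': "insert g F' \<subseteq> carrier R" using insert.prems assms(5) by blast
      have "r \<otimes>\<^bsub>R\<^esub> s \<notin> P" using P.I_prime r s by blast
      moreover have "(r \<otimes>\<^bsub>R\<^esub> s) \<otimes>\<^bsub>R\<^esub> (f \<otimes>\<^bsub>R\<^esub> h) \<in> J'" if h: "h \<in> insert g F'" for h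
      proof -
        have hc: "f \<otimes>\<^bsub>R\<^esub> h \<in> carrier R" using h F' f by blast
        show ?thesis
        proof (cases "h = g")
          case True
          then show ?thesis using J'.I_l_closed[OF s(3) r(1)] hc r(1) s(1) by (simp add: R.m_assoc)
        next
          case False
          then have "s \<otimes>\<^bsub>R\<^esub> (r \<otimes>\<^bsub>R\<^esub> (f \<otimes>\<^bsub>R\<^esub> h)) \<in> J'"
            using J'.I_l_closed[OF r(3) s(1)] h by blast
          then show ?thesis using hc r(1) s(1) by (simp add: R.m_assoc R.m_lcomm)
        qed
      qed
      ultimately show ?case using r(1) s(1) by (intro bexI[of _ "r \<otimes>\<^bsub>R\<^esub> s"]) simp_all
    qed
    from this[OF subset_refl] obtain r where
      r: "r \<in> carrier R" "r \<notin> P" "\<And>g. g \<in> F \<Longrightarrow> r \<otimes>\<^bsub>R\<^esub> (f \<otimes>\<^bsub>R\<^esub> g) \<in> J'"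
      by blast
    have "r \<otimes>\<^bsub>R\<^esub> f \<in> J"
    proof (rule colon)
      fix g assume g: "g \<in> F"
      then have "g \<in> carrier R" using assms(5) by blast
      then show "r \<otimes>\<^bsub>R\<^esub> f \<otimes>\<^bsub>R\<^esub> g \<in> J'" using r(3)[OF g] r(1) f by (simp add: R.m_assoc)
    qed (use r(1) f in simp)
    then have "r \<in> P" unfolding P_eq using r(1) by blast
    then show False using r(2) by contradiction
  qed
  then obtain g where g: "g \<in> F" and sub: "{r \<in> carrier R. r \<otimes>\<^bsub>R\<^esub> (f \<otimes>\<^bsub>R\<^esub> g) \<in> J'} \<subseteq> P" by blast
  have gc: "g \<in> carrier R" using g assms(5) by blast
  have "P \<subseteq> {r \<in> carrier R. r \<otimes>\<^bsub>R\<^esub> (f \<otimes>\<^bsub>R\<^esub> g) \<in> J'}"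
  proof
    fix r assume r: "r \<in> P"
    then have "r \<otimes>\<^bsub>R\<^esub> f \<in> J" unfolding P_eq by blast
    then have "r \<otimes>\<^bsub>R\<^esub> f \<otimes>\<^bsub>R\<^esub> g \<in> J'" using g by (rule mult)
    then show "r \<in> {r \<in> carrier R. r \<otimes>\<^bsub>R\<^esub> (f \<otimes>\<^bsub>R\<^esub> g) \<in> J'}"
      using r gc f P.Icarr by (simp add: R.m_assoc)
  qed
  with sub have "P = {r \<in> carrier R. r \<otimes>\<^bsub>R\<^esub> (f \<otimes>\<^bsub>R\<^esub> g) \<in> J'}" by blast
  moreover have "f \<otimes>\<^bsub>R\<^esub> g \<in> carrier R" using f gc by simp
  ultimately show ?thesis
    using prime Ass_iff[OF assms(1,3)] by blast
qed

section \<open>Exponent vectors in powers of a squarefree principal Borel ideal\<close>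

definition set_mon :: "nat set \<Rightarrow> (nat \<Rightarrow>\<^sub>0 nat)" where
  "set_mon B = (\<Sum>i\<in>B. var i)"

text \<open>Infinite sums default to 0, so an infinite \<open>B\<close> would give the exponent
  vector 0; hence the finiteness hypothesis here and below.\<close>

lemma lookup_set_mon:
  assumes "finite B"
  shows "Poly_Mapping.lookup (set_mon B) i = (if i \<in> B then 1 else 0)"
  using assms by (simp add: set_mon_def lookup_sum lookup_single when_def)

lemma keys_set_mon:
  assumes "finite B"
  shows "Poly_Mapping.keys (set_mon B) = B"
  using assms by (auto simp: in_keys_iff lookup_set_mon split: if_splits)

lemma set_mon_monomials:
  assumes "B \<subseteq> {1..n}"
  shows "set_mon B \<in> monomials n"
proof -
  have "finite B" using assms finite_subset by blast
  then show ?thesis using assms by (simp add: monomials_def keys_set_mon)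
qed

lemma mon_deg_set_mon:
  assumes "finite B"
  shows "mon_deg (set_mon B) = card B"
  using assms by (simp add: mon_deg_def keys_set_mon lookup_set_mon)

lemma squarefree_mon_set_mon: "finite B \<Longrightarrow> squarefree_mon (set_mon B)"
  by (simp add: squarefree_mon_def lookup_set_mon)

lemma set_mon_keys:
  assumes "squarefree_mon u"
  shows "set_mon (Poly_Mapping.keys u) = u"
proof (rule poly_mapping_eqI)
  fix i
  have "Poly_Mapping.lookup u i \<le> 1" using assms by (simp add: squarefree_mon_def)
  then show "Poly_Mapping.lookup (set_mon (Poly_Mapping.keys u)) i = Poly_Mapping.lookup u i"
    by (auto simp: lookup_set_mon in_keys_iff)
qed

lemma set_mon_exchange:
  assumes "finite B" "j \<in> B" "i \<notin> B"
  shows "var i + (set_mon B - var j) = set_mon (insert i (B - {j}))"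
  using assms
  by (intro poly_mapping_eqI) (auto simp: lookup_add lookup_minus lookup_single lookup_set_mon when_def)

lemma set_mon_dvd:
  assumes "u \<in> monomials n" "B \<subseteq> Poly_Mapping.keys u"
  shows "\<exists>s\<in>monomials n. u = s + set_mon B"
proof
  have B: "finite B" using assms(2) finite_subset[OF _ finite_keys] by blast
  show "u = (u - set_mon B) + set_mon B"
  proof (rule poly_mapping_eqI)
    fix i
    show "Poly_Mapping.lookup u i = Poly_Mapping.lookup (u - set_mon B + set_mon B) i"
      using assms(2) B by (auto simp: lookup_add lookup_minus lookup_set_mon in_keys_iff)
  qed
  show "u - set_mon B \<in> monomials n"
    using assms B by (auto simp: monomials_def in_keys_iff lookup_minus lookup_set_mon)
qed

text \<open>\<open>borel_sets n U\<close> encodes \<open>G(I)\<close> for the Borel generator with support \<open>U\<close>: the condition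
  \<open>j\<^sub>k \<le> i\<^sub>k\<close> for all \<open>k\<close> says that every initial segment contains at least as many of the \<open>j\<^sub>k\<close> as
  of the \<open>i\<^sub>k\<close>.\<close>

definition borel_sets :: "nat \<Rightarrow> nat set \<Rightarrow> nat set set" where
  "borel_sets n U =
    {B. B \<subseteq> {1..n} \<and> card B = card U \<and> (\<forall>s. card (U \<inter> {..<s}) \<le> card (B \<inter> {..<s}))}"

text \<open>The exponent vectors of the monomials in \<open>I\<^sup>k\<close>. The exponents are cut off at \<open>k\<close>
  because each of the \<open>k\<close> squarefree factors uses \<open>x\<^sub>j\<close> at most once.\<close>

definition borel_mons :: "nat \<Rightarrow> nat set \<Rightarrow> nat \<Rightarrow> (nat \<Rightarrow>\<^sub>0 nat) set" where
  "borel_mons n U k =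
    {v \<in> monomials n. \<forall>s. k * card (U \<inter> {..<s}) \<le> (\<Sum>j<s. min (Poly_Mapping.lookup v j) k)}"

text \<open>\<open>E\<close> consists of the \<open>m\<close> smallest elements of \<open>S\<close>.
  The dichotomy says this without an enumeration: either \<open>s\<close> lies beyond all of
  \<open>E\<close>, or everything in \<open>S\<close> below \<open>s\<close> has been
  chosen.\<close>

lemma initial_segment:
  fixes S :: "nat set"
  assumes "finite S" "m \<le> card S"
  shows "\<exists>E\<subseteq>S. card E = m \<and> (\<forall>s. E \<subseteq> {..<s} \<or> S \<inter> {..<s} \<subseteq> E)"
  using assms
proof (induction S arbitrary: m rule: finite_linorder_max_induct)
  case empty
  then show ?case by simp
next
  case (insert b S)
  show ?case
  proof (cases "m \<le> card S")
    case True
    with insert.IH obtain E where E: "E \<subseteq> S" "card E = m" "\<forall>s. E \<subseteq> {..<s} \<or> S \<inter> {..<s} \<subseteq> E"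
      by blast
    have "E \<subseteq> {..<s} \<or> insert b S \<inter> {..<s} \<subseteq> E" for s
    proof (cases "b < s")
      case True
      then have "E \<subseteq> {..<s}" using E(1) insert.hyps by fastforce
      then show ?thesis ..
    next
      case False
      then have "insert b S \<inter> {..<s} = S \<inter> {..<s}" by auto
      then show ?thesis using E(3) by simp
    qed
    then show ?thesis using E by blast
  next
    case False
    then have "m = card (insert b S)" using insert by (auto simp: card_insert_if)
    then show ?thesis by blast
  qed
qed

lemma sum_indicator_lessThan:
  fixes s :: nat
  shows "(\<Sum>j<s. if j \<in> B then 1 else (0::nat)) = card (B \<inter> {..<s})"
  by (simp add: sum.If_cases Int_commute)

lemma set_mon_borel_mons:
  assumes "B \<in> borel_sets n U"
  shows "set_mon B \<in> borel_mons n U 1"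
proof -
  have B: "finite B" using assms finite_subset by (auto simp: borel_sets_def)
  have "(\<Sum>j<s. min (Poly_Mapping.lookup (set_mon B) j) 1) = card (B \<inter> {..<s})" for s
    unfolding sum_indicator_lessThan[symmetric] using B by (intro sum.cong) (auto simp: lookup_set_mon)
  then show ?thesis
    using assms set_mon_monomials by (simp add: borel_mons_def borel_sets_def)
qed

text \<open>The cutoff is superadditive, \<open>min a k + min b l <= min (a + b) (k + l)\<close>, so
  the defining inequalities add up.\<close>

lemma borel_mons_add:
  assumes "v \<in> borel_mons n U k" "w \<in> borel_mons n U l"
  shows "v + w \<in> borel_mons n U (k + l)"
proof -
  have "(k + l) * card (U \<inter> {..<s}) \<le>
      (\<Sum>j<s. min (Poly_Mapping.lookup (v + w) j) (k + l))" for s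
  proof -
    have "(k + l) * card (U \<inter> {..<s}) = k * card (U \<inter> {..<s}) + l * card (U \<inter> {..<s})"
      by (simp add: algebra_simps)
    also have "\<dots> \<le> (\<Sum>j<s. min (Poly_Mapping.lookup v j) k) + (\<Sum>j<s. min (Poly_Mapping.lookup w j) l)"
      using assms by (intro add_mono) (auto simp: borel_mons_def)
    also have "\<dots> \<le> (\<Sum>j<s. min (Poly_Mapping.lookup (v + w) j) (k + l))"
      unfolding sum.distrib[symmetric] by (intro sum_mono) (simp add: lookup_add min_def)
    finally show ?thesis .
  qed
  then show ?thesis
    using assms by (simp add: borel_mons_def monomials_add)
qed

lemma borel_mons_0: "borel_mons n U 0 = monomials n"
  by (simp add: borel_mons_def)

lemma monomials_minus: "v \<in> monomials n \<Longrightarrow> v - w \<in> monomials n"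
  by (auto simp: monomials_def in_keys_iff lookup_minus)

text \<open>List the variables of \<open>v\<close>, each at most \<open>k + 1\<close> times, in increasing order and take every
  \<open>(k+1)\<close>-st entry of the list.\<close>

lemma borel_mons_Suc_split:
  assumes v: "v \<in> borel_mons n U (Suc k)"
  shows "\<exists>w\<in>borel_mons n U k. \<exists>g\<in>borel_mons n U 1. v = w + g"
proof -
  \<comment> \<open>\<open>Q s\<close> counts the list entries below \<open>s\<close>, and
    \<open>q s\<close> the complete blocks of length \<open>k + 1\<close> among them. Thus
    \<open>B\<close> collects the variables at positions divisible by \<open>k + 1\<close>.\<close>
  define x where "x j = min (Poly_Mapping.lookup v j) (Suc k)" for j
  define Q where "Q s = (\<Sum>j<s. x j)" for s
  define q where "q s = Q s div Suc k" for s
  define B where "B = {j. q j < q (Suc j)}"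
  have vm: "v \<in> monomials n" and U: "Suc k * card (U \<inter> {..<s}) \<le> Q s" for s
    using v by (auto simp: borel_mons_def Q_def x_def)
  have Q_Suc: "Q (Suc s) = Q s + x s" for s by (simp add: Q_def)
  have x_le: "x j \<le> Suc k" for j by (simp add: x_def)
  \<comment> \<open>A variable occupies at most \<open>k + 1\<close> consecutive positions and so
    meets at most one block end. Hence \<open>q\<close> counts the elements of
    \<open>B\<close>.\<close>
  have q_Suc: "q (Suc j) = q j + (if j \<in> B then 1 else 0)" for j
  proof -
    have "q j \<le> q (Suc j)" unfolding q_def by (intro div_le_mono) (simp add: Q_Suc)
    moreover have "q (Suc j) \<le> (Q j + Suc k) div Suc k"
      unfolding q_def by (intro div_le_mono) (simp add: Q_Suc x_le del: add_Suc_right)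
    moreover have "(Q j + Suc k) div Suc k = q j + 1"
      using div_add_self2[of "Suc k" "Q j"] by (simp add: q_def del: add_Suc_right)
    ultimately show ?thesis by (auto simp: B_def)
  qed
  have q_eq: "q s = card (B \<inter> {..<s})" for s
    unfolding sum_indicator_lessThan[symmetric]
    by (induction s) (simp_all add: q_Suc, simp add: q_def Q_def)
  have cq: "card (U \<inter> {..<s}) \<le> q s" for s
    unfolding q_def using U[of s] by (simp add: less_eq_div_iff_mult_less_eq mult.commute del: mult_Suc)
  have Bx: "j \<in> B \<Longrightarrow> 0 < x j" for j
    by (rule ccontr) (simp add: B_def q_def Q_Suc)
  \<comment> \<open>Any \<open>k + 1\<close> consecutive positions contain a block end. Hence no
    variable outside \<open>B\<close> loses anything when the cutoff drops to
    \<open>k\<close>.\<close>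
  have xB: "j \<in> B" if "x j = Suc k" for j
    using that div_add_self2[of "Suc k" "Q j"]
    unfolding B_def q_def by (simp add: Q_Suc del: add_Suc_right)
  have Bk: "B \<subseteq> Poly_Mapping.keys v"
    using Bx by (auto simp: x_def in_keys_iff)
  then have fB: "finite B" by (rule finite_subset) simp
  let ?g = "set_mon B" and ?w = "v - set_mon B"
  have "?g \<in> borel_mons n U 1"
  proof -
    have "card (U \<inter> {..<s}) \<le> card (B \<inter> {..<s})" for s
      using cq[of s] by (simp add: q_eq)
    moreover have "(\<Sum>j<s. min (Poly_Mapping.lookup ?g j) 1) = card (B \<inter> {..<s})" for s
      unfolding sum_indicator_lessThan[symmetric] using fB by (intro sum.cong) (auto simp: lookup_set_mon)
    moreover have "?g \<in> monomials n"
      using vm Bk fB by (auto simp: monomials_def keys_set_mon)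
    ultimately show ?thesis by (simp add: borel_mons_def)
  qed
  moreover have "?w \<in> borel_mons n U k"
  proof -
    have "k * card (U \<inter> {..<s}) \<le> (\<Sum>j<s. min (Poly_Mapping.lookup ?w j) k)" for s
    proof -
      \<comment> \<open>The complete blocks below \<open>s\<close> have \<open>k + 1\<close> entries
        each; removing one entry per block leaves at least \<open>k * q s\<close>.\<close>
      have "Suc k * q s \<le> Q s" unfolding q_def by (rule times_div_less_eq_dividend)
      moreover have "k * card (U \<inter> {..<s}) \<le> k * q s"
        by (rule mult_le_mono2[OF cq])
      ultimately have "k * card (U \<inter> {..<s}) + q s \<le> Q s" unfolding mult_Suc by linarith
      moreover have "Q s = (\<Sum>j<s. min (Poly_Mapping.lookup ?w j) k) + q s"
        unfolding Q_def q_eq sum_indicator_lessThan[symmetric] sum.distrib[symmetric]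
      proof (rule sum.cong)
        fix j
        show "x j = min (Poly_Mapping.lookup ?w j) k + (if j \<in> B then 1 else 0)"
          using Bx[of j] xB[of j] fB by (auto simp: x_def lookup_minus lookup_set_mon min_def split: if_splits)
      qed simp
      ultimately show ?thesis by simp
    qed
    then show ?thesis using vm monomials_minus by (simp add: borel_mons_def)
  qed
  moreover have "v = ?w + ?g"
    using Bk fB
    by (intro poly_mapping_eqI) (auto simp: lookup_add lookup_minus lookup_set_mon in_keys_iff)
  ultimately show ?thesis by blast
qed

text \<open>The \<open>card U\<close> smallest variables in the support of \<open>v\<close> form a
  Borel set: below any \<open>s\<close> they are either all present or agree with the whole
  support.\<close>

lemma borel_mons_1_dvd:
  assumes U: "U \<subseteq> {1..n}" and v: "v \<in> borel_mons n U 1"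
  shows "\<exists>B\<in>borel_sets n U. B \<subseteq> Poly_Mapping.keys v"
proof -
  let ?S = "Poly_Mapping.keys v"
  have S: "card (U \<inter> {..<s}) \<le> card (?S \<inter> {..<s})" for s
  proof -
    have "card (U \<inter> {..<s}) \<le> (\<Sum>j<s. min (Poly_Mapping.lookup v j) 1)"
      using v by (simp add: borel_mons_def)
    also have "\<dots> = card (?S \<inter> {..<s})"
      unfolding sum_indicator_lessThan[symmetric] by (intro sum.cong) (auto simp: in_keys_iff)
    finally show ?thesis .
  qed
  have Sn: "?S \<subseteq> {1..n}" using v by (simp add: borel_mons_def monomials_def)
  \<comment> \<open>Segments are strict, so \<open>Suc n\<close> is the bound that captures all of
    \<open>{1..n}\<close>.\<close>
  have "U \<inter> {..<Suc n} = U" "?S \<inter> {..<Suc n} = ?S" using U Sn by auto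
  then have "card U \<le> card ?S" using S[of "Suc n"] by simp
  from initial_segment[OF finite_keys this] obtain E where E: "E \<subseteq> ?S" "card E = card U" "\<forall>s. E \<subseteq> {..<s} \<or> ?S \<inter> {..<s} \<subseteq> E"
    by auto
  have fU: "finite U" using U by (rule finite_subset) simp
  have fE: "finite E" using E(1) finite_subset[OF _ finite_keys] by blast
  have "card (U \<inter> {..<s}) \<le> card (E \<inter> {..<s})" for s
  proof (cases "E \<subseteq> {..<s}")
    case True
    then have "E \<inter> {..<s} = E" by blast
    then show ?thesis using E(2) fU by (simp add: card_mono)
  next
    case False
    with E(3) have "?S \<inter> {..<s} \<subseteq> E" by blast
    then have "?S \<inter> {..<s} \<subseteq> E \<inter> {..<s}" by blast
    then have "card (?S \<inter> {..<s}) \<le> card (E \<inter> {..<s})" using fE by (intro card_mono) auto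
    then show ?thesis using S[of s] by simp
  qed
  with E(1,2) Sn have "E \<in> borel_sets n U" by (simp add: borel_sets_def)
  with E(1) show ?thesis by blast
qed

text \<open>A violated inequality at the least possible \<open>t\<close> survives the multiplication by the monomial
  of a Borel set which has as few elements below \<open>t\<close> as possible and contains all the variables
  where \<open>v\<close> has exponent at least \<open>k\<close>.\<close>

lemma borel_mons_colon:
  assumes U: "U \<subseteq> {1..n}" and vm: "v \<in> monomials n"
    and colon: "\<And>B. B \<in> borel_sets n U \<Longrightarrow> v + set_mon B \<in> borel_mons n U (Suc k)"
  shows "v \<in> borel_mons n U k"
proof (rule ccontr)
  let ?c = "\<lambda>s. card (U \<inter> {..<s})"
  define x where "x j = min (Poly_Mapping.lookup v j) k" for j
  define Q where "Q s = (\<Sum>j<s. x j)" for s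
  assume "v \<notin> borel_mons n U k"
  then have "\<exists>t. Q t < k * ?c t"
    using vm by (auto simp: borel_mons_def Q_def x_def not_le)
  then obtain t where t: "Q t < k * ?c t" and least: "\<And>s. s < t \<Longrightarrow> k * ?c s \<le> Q s"
    using exists_least_iff[of "\<lambda>t. Q t < k * ?c t"] by (auto simp: not_less)
  then have k: "0 < k" by (cases k) auto
  have fU: "finite U" using U by (rule finite_subset) simp
  define T where "T = {1..n} \<inter> {..<t}"
  \<comment> \<open>Raising the cutoff from \<open>k\<close> to \<open>k + 1\<close> can by itself
    add one at such a \<open>j\<close>. Putting these \<open>j\<close> into \<open>B\<close> lets
    the count of \<open>B\<close> absorb that gain.\<close>
  define A where "A = {j. j < t \<and> k \<le> Poly_Mapping.lookup v j}"
  have fT: "finite T" by (simp add: T_def)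
  have AT: "A \<subseteq> T"
  proof
    fix j assume j: "j \<in> A"
    then have "j \<in> Poly_Mapping.keys v" using k by (auto simp: A_def in_keys_iff)
    then show "j \<in> T" using vm j by (auto simp: monomials_def T_def A_def)
  qed
  then have fA: "finite A" using fT finite_subset by blast
  have UT: "U \<inter> {..<t} \<subseteq> T" using U by (auto simp: T_def)
  \<comment> \<open>Each element of \<open>A\<close> from \<open>s\<close> on contributes a full
    \<open>k\<close> to \<open>Q t\<close>, and minimality of \<open>t\<close> bounds
    \<open>Q s\<close> from below. Too many such elements would restore the inequality at
    \<open>t\<close>.\<close>
  have A_tail: "card (A \<inter> {s..}) + ?c s \<le> ?c t" if "s \<le> t" for s
  proof (cases "s = t")
    case True
    then have "A \<inter> {s..} = {}" by (auto simp: A_def)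
    then show ?thesis using True by simp
  next
    case False
    then have st: "s < t" using that by simp
    have "(\<Sum>j\<in>A \<inter> {s..}. x j) = (\<Sum>j\<in>A \<inter> {s..}. k)"
      by (intro sum.cong) (auto simp: A_def x_def)
    then have "card (A \<inter> {s..}) * k = (\<Sum>j\<in>A \<inter> {s..}. x j)" by simp
    also have "\<dots> \<le> (\<Sum>j\<in>{s..<t}. x j)"
      by (intro sum_mono2) (auto simp: A_def)
    finally have "card (A \<inter> {s..}) * k \<le> (\<Sum>j\<in>{s..<t}. x j)" .
    moreover have "Q t = Q s + (\<Sum>j\<in>{s..<t}. x j)"
      using st by (simp add: Q_def lessThan_atLeast0 sum.atLeastLessThan_concat)
    ultimately have "(card (A \<inter> {s..}) + ?c s) * k < ?c t * k"
      using t least[OF st] by (simp add: algebra_simps)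
    then show ?thesis by simp
  qed
  have "A \<inter> {0..} = A" by auto
  then have cA: "card A \<le> ?c t" using A_tail[of 0] by simp
  \<comment> \<open>There is room to fill \<open>A\<close> up with the smallest remaining variables
    until it has as many elements as \<open>U\<close> has below \<open>t\<close>.\<close>
  have "?c t - card A \<le> card (T - A)"
    using card_mono[OF fT UT] AT fA by (simp add: card_Diff_subset)
  then obtain E where E: "E \<subseteq> T - A" "card E = ?c t - card A"
      "\<And>s. E \<subseteq> {..<s} \<or> (T - A) \<inter> {..<s} \<subseteq> E"
    using initial_segment[of "T - A" "?c t - card A"] fT by auto
  define D where "D = A \<union> E"
  define B where "B = D \<union> (U \<inter> {t..})"
  have fE: "finite E" using E(1) fT finite_subset by blast
  then have fD: "finite D" using fA by (simp add: D_def)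
  have DT: "D \<subseteq> T" using AT E(1) by (auto simp: D_def)
  have cD: "card D = ?c t"
    unfolding D_def using E(1,2) fA fE cA by (subst card_Un_disjoint) auto
  have B_low: "B \<inter> {..<s} = D \<inter> {..<s}" if "s \<le> t" for s
    using that by (auto simp: B_def)
  \<comment> \<open>If \<open>E\<close> ends before \<open>s\<close>, the elements of
    \<open>D\<close> from \<open>s\<close> on all lie in \<open>A\<close> and \<open>A_tail\<close>
    bounds them. Otherwise \<open>D\<close> contains all of \<open>T\<close> below \<open>s\<close>,
    hence all of \<open>U\<close> there.\<close>
  have D_count: "?c s \<le> card (D \<inter> {..<s})" if "s \<le> t" for s
  proof (cases "E \<subseteq> {..<s}")
    case True
    have "D \<subseteq> (D \<inter> {..<s}) \<union> (A \<inter> {s..})" using True by (auto simp: D_def)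
    then have "card D \<le> card ((D \<inter> {..<s}) \<union> (A \<inter> {s..}))"
      using fD fA by (intro card_mono) auto
    also have "\<dots> \<le> card (D \<inter> {..<s}) + card (A \<inter> {s..})" by (rule card_Un_le)
    finally have "card D \<le> card (D \<inter> {..<s}) + card (A \<inter> {s..})" .
    then show ?thesis using A_tail[OF that] cD by linarith
  next
    case False
    with E(3)[of s] have "(T - A) \<inter> {..<s} \<subseteq> E" by simp
    moreover have "U \<inter> {..<s} \<subseteq> T" using UT that by auto
    ultimately have "U \<inter> {..<s} \<subseteq> D \<inter> {..<s}" unfolding D_def by blast
    then show ?thesis using fD by (intro card_mono) auto
  qed
  \<comment> \<open>Taking \<open>X = UNIV\<close> gives the cardinality of \<open>B\<close>;
    segments reaching at least to \<open>t\<close> give the remaining counts.\<close>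
  have high: "card (B \<inter> X) = card (U \<inter> X)" if "{..<t} \<subseteq> X" for X
  proof -
    have "B \<inter> X = D \<union> (U \<inter> {t..} \<inter> X)" "D \<inter> (U \<inter> {t..} \<inter> X) = {}"
      using DT that by (auto simp: B_def T_def)
    then have "card (B \<inter> X) = ?c t + card (U \<inter> {t..} \<inter> X)"
      using fD fU cD by (simp add: card_Un_disjoint)
    also have "\<dots> = card ((U \<inter> {..<t}) \<union> (U \<inter> {t..} \<inter> X))"
      using fU by (subst card_Un_disjoint) auto
    also have "(U \<inter> {..<t}) \<union> (U \<inter> {t..} \<inter> X) = U \<inter> X" using that by auto
    finally show ?thesis .
  qed
  have "B \<in> borel_sets n U"
    unfolding borel_sets_def
  proof (intro CollectI conjI allI)
    show "B \<subseteq> {1..n}" using DT U by (auto simp: B_def T_def)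
    show "card B = card U" using high[of UNIV] by simp
    fix s
    show "?c s \<le> card (B \<inter> {..<s})"
    proof (cases "s \<le> t")
      case True
      then show ?thesis using D_count B_low by simp
    next
      case False
      then show ?thesis using high[of "{..<s}"] by auto
    qed
  qed
  from colon[OF this] have
    "Suc k * ?c t \<le> (\<Sum>j<t. min (Poly_Mapping.lookup (v + set_mon B) j) (Suc k))"
    by (simp add: borel_mons_def)
  also have "\<dots> \<le> (\<Sum>j<t. x j + (if j \<in> B then 1 else 0))"
  proof (rule sum_mono)
    fix j assume "j \<in> {..<t}"
    moreover have "finite B" using fD fU by (simp add: B_def)
    ultimately show "min (Poly_Mapping.lookup (v + set_mon B) j) (Suc k) \<le> x j + (if j \<in> B then 1 else 0)"
      by (auto simp: x_def lookup_add lookup_set_mon B_def D_def A_def)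
  qed
  also have "\<dots> = Q t + card (B \<inter> {..<t})"
    by (simp add: sum.distrib sum_indicator_lessThan Q_def del: sum.If_cases)
  also have "\<dots> = Q t + ?c t" using high[of "{..<t}"] by simp
  finally show False using t by simp
qed

section \<open>Powers as ideals\<close>

text \<open>Membership depends on the support alone, so ideals can be replaced by sets of exponent
  vectors closed under multiples.\<close>

lemma Idl_mon_upclosed:
  assumes "W \<subseteq> monomials n" "M \<subseteq> W"
    and up: "\<And>s w. w \<in> W \<Longrightarrow> s \<in> monomials n \<Longrightarrow> s + w \<in> W"
    and gen: "\<And>w. w \<in> W \<Longrightarrow> \<exists>g\<in>M. \<exists>s\<in>monomials n. w = s + g"
  shows "Idl\<^bsub>poly_ring n\<^esub> (mon ` M) =
    {p :: (nat \<Rightarrow>\<^sub>0 nat) \<Rightarrow>\<^sub>0 'k::field. Poly_Mapping.keys p \<subseteq> W}"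
proof -
  have "M \<subseteq> monomials n" using assms by blast
  have "t \<in> monomials n \<and> (\<exists>g\<in>M. \<exists>s\<in>monomials n. t = s + g) \<longleftrightarrow> t \<in> W" for t
    using assms(1,2) up gen[of t] by blast
  then show ?thesis
    unfolding Idl_mon[OF \<open>M \<subseteq> monomials n\<close>] by blast
qed

lemma ideal_Idl_mon:
  assumes "M \<subseteq> monomials n"
  shows "ideal (Idl\<^bsub>poly_ring n\<^esub> (mon ` M :: ((nat \<Rightarrow>\<^sub>0 nat) \<Rightarrow>\<^sub>0 'k::field) set)) (poly_ring n)"
proof -
  interpret R: cring "poly_ring n :: ((nat \<Rightarrow>\<^sub>0 nat) \<Rightarrow>\<^sub>0 'k) ring" by (rule cring_poly_ring)
  have "(mon ` M :: ((nat \<Rightarrow>\<^sub>0 nat) \<Rightarrow>\<^sub>0 'k) set) \<subseteq> carrier (poly_ring n)"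
    using assms by (auto simp: poly_ring_def mon_def)
  then show ?thesis by (rule R.genideal_ideal)
qed

lemma mon_add: "mon (u + v) = mon u * (mon v :: (nat \<Rightarrow>\<^sub>0 nat) \<Rightarrow>\<^sub>0 'k::field)"
  by (simp add: mon_def mult_single)

text \<open>This is \<open>borel_mons_add\<close> with exponent 0, where the inequalities are
  vacuous.\<close>

lemma borel_mons_up:
  assumes "w \<in> borel_mons n U k" "s \<in> monomials n"
  shows "s + w \<in> borel_mons n U k"
  using borel_mons_add[of s n U 0 w k] assms by (simp add: borel_mons_0)

lemma borel_mons_monomials: "borel_mons n U k \<subseteq> monomials n"
  by (auto simp: borel_mons_def)

lemma Idl_borel_mons:
  "Idl\<^bsub>poly_ring n\<^esub> (mon ` borel_mons n U k) =
    {p :: (nat \<Rightarrow>\<^sub>0 nat) \<Rightarrow>\<^sub>0 'k::field. Poly_Mapping.keys p \<subseteq> borel_mons n U k}"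
proof (rule Idl_mon_upclosed[OF borel_mons_monomials subset_refl borel_mons_up])
  fix w assume "w \<in> borel_mons n U k"
  then show "\<exists>g\<in>borel_mons n U k. \<exists>s\<in>monomials n. w = s + g"
    using monomials_0 by (intro bexI[of _ w] bexI[of _ 0]) auto
qed

lemma Idl_borel_sets:
  assumes "U \<subseteq> {1..n}"
  shows "Idl\<^bsub>poly_ring n\<^esub> (mon ` set_mon ` borel_sets n U) =
    {p :: (nat \<Rightarrow>\<^sub>0 nat) \<Rightarrow>\<^sub>0 'k::field. Poly_Mapping.keys p \<subseteq> borel_mons n U 1}"
proof (rule Idl_mon_upclosed[OF borel_mons_monomials _ borel_mons_up])
  show "set_mon ` borel_sets n U \<subseteq> borel_mons n U 1"
    using set_mon_borel_mons by blast
  fix w assume w: "w \<in> borel_mons n U 1"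
  with borel_mons_1_dvd[OF assms] obtain B where "B \<in> borel_sets n U" "B \<subseteq> Poly_Mapping.keys w"
    by blast
  moreover have "w \<in> monomials n" using w borel_mons_monomials by blast
  ultimately show "\<exists>g\<in>set_mon ` borel_sets n U. \<exists>s\<in>monomials n. w = s + g"
    using set_mon_dvd by blast
qed

text \<open>In the induction step one inclusion is \<open>borel_mons_add\<close> and the other is
  \<open>borel_mons_Suc_split\<close>. The zeroth power is the whole ring.\<close>

lemma ideal_power_borel:
  fixes n :: nat
  defines "X \<equiv> \<lambda>U k. {p :: (nat \<Rightarrow>\<^sub>0 nat) \<Rightarrow>\<^sub>0 'k::field. Poly_Mapping.keys p \<subseteq> borel_mons n U k}"
  shows "ideal_power (poly_ring n) (X U 1) k = X U k"
proof (induction k)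
  case 0
  show ?case
    by (simp add: ideal_power_def ideals_set_def poly_ring_def X_def borel_mons_0)
next
  case (Suc k)
  interpret R: cring "poly_ring n :: ((nat \<Rightarrow>\<^sub>0 nat) \<Rightarrow>\<^sub>0 'k) ring" by (rule cring_poly_ring)
  have Idl: "X U l = Idl\<^bsub>poly_ring n\<^esub> (mon ` borel_mons n U l)" for l
    unfolding X_def by (rule Idl_borel_mons[symmetric])
  have id: "ideal (X U l) (poly_ring n)" for l
    unfolding Idl by (rule ideal_Idl_mon[OF borel_mons_monomials])
  interpret XS: ideal "X U (Suc k)" "poly_ring n" by (rule id)
  have "ideal_prod (poly_ring n) (X U k) (X U 1) = X U (Suc k)"
  proof
    show "ideal_prod (poly_ring n) (X U k) (X U 1) \<subseteq> X U (Suc k)"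
    proof
      fix p assume "p \<in> ideal_prod (poly_ring n) (X U k) (X U 1)"
      then show "p \<in> X U (Suc k)"
      proof (induction rule: ideal_prod.induct)
        case (prod a b)
        have "Poly_Mapping.keys (a * b) \<subseteq> borel_mons n U (Suc k)"
          using keys_mult[of a b] prod borel_mons_add[of _ n U k _ 1] by (force simp: X_def)
        then show ?case by (simp add: X_def poly_ring_def)
      next
        case (sum a b)
        then show ?case by simp
      qed
    qed
    have "(mon ` borel_mons n U (Suc k) :: ((nat \<Rightarrow>\<^sub>0 nat) \<Rightarrow>\<^sub>0 'k) set)
        \<subseteq> ideal_prod (poly_ring n) (X U k) (X U 1)"
    proof
      fix p :: "(nat \<Rightarrow>\<^sub>0 nat) \<Rightarrow>\<^sub>0 'k" assume "p \<in> mon ` borel_mons n U (Suc k)"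
      then obtain v where v: "v \<in> borel_mons n U (Suc k)" "p = mon v" by blast
      from borel_mons_Suc_split[OF v(1)] obtain w g where
        wg: "w \<in> borel_mons n U k" "g \<in> borel_mons n U 1" "v = w + g" by blast
      then have "mon w \<in> X U k" "mon g \<in> X U 1" by (simp_all add: X_def mon_def)
      then have "mon w \<otimes>\<^bsub>poly_ring n\<^esub> mon g \<in> ideal_prod (poly_ring n) (X U k) (X U 1)"
        by (rule ideal_prod.prod)
      then show "p \<in> ideal_prod (poly_ring n) (X U k) (X U 1)"
        using v(2) wg(3) by (simp add: mon_add poly_ring_def)
    qed
    then show "X U (Suc k) \<subseteq> ideal_prod (poly_ring n) (X U k) (X U 1)"
      unfolding Idl[of "Suc k"] by (rule R.genideal_minimal[OF R.ideal_prod_is_ideal[OF id id]])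
  qed
  then show ?case
    using Suc.IH by (simp add: ideal_power_def ideals_set_def)
qed

text \<open>Split off the \<open>v\<close> term of \<open>f\<close>: by cancellation of exponents no
  other term contributes to \<open>v + u\<close>.\<close>

lemma lookup_mult_mon:
  "Poly_Mapping.lookup (f * mon u :: (nat \<Rightarrow>\<^sub>0 nat) \<Rightarrow>\<^sub>0 'k::field) (v + u) = Poly_Mapping.lookup f v"
proof -
  let ?c = "Poly_Mapping.single v (Poly_Mapping.lookup f v)"
  have "v \<notin> Poly_Mapping.keys (f - ?c)" by (simp add: in_keys_iff lookup_minus)
  then have "v + u \<notin> Poly_Mapping.keys ((f - ?c) * mon u)"
    using keys_mult[of "f - ?c" "mon u"] by (auto simp: mon_def)
  then have "Poly_Mapping.lookup ((f - ?c) * mon u) (v + u) = 0" by (simp add: in_keys_iff)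
  moreover have "?c * mon u = Poly_Mapping.single (v + u) (Poly_Mapping.lookup f v)"
    by (simp add: mon_def mult_single)
  ultimately show ?thesis by (simp add: left_diff_distrib lookup_minus)
qed

text \<open>Multiplication by a monomial translates the support without cancellation, so the
  condition on \<open>f\<close> splits into one for each of its exponent vectors.\<close>

lemma borel_colon:
  fixes f :: "(nat \<Rightarrow>\<^sub>0 nat) \<Rightarrow>\<^sub>0 'k::field"
  assumes U: "U \<subseteq> {1..n}" and f: "Poly_Mapping.keys f \<subseteq> monomials n"
    and colon: "\<And>B. B \<in> borel_sets n U \<Longrightarrow>
      Poly_Mapping.keys (f * mon (set_mon B)) \<subseteq> borel_mons n U (Suc k)"
  shows "Poly_Mapping.keys f \<subseteq> borel_mons n U k"
proof
  fix v assume v: "v \<in> Poly_Mapping.keys f"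
  show "v \<in> borel_mons n U k"
  proof (rule borel_mons_colon[OF U])
    show "v \<in> monomials n" using v f by blast
    fix B assume B: "B \<in> borel_sets n U"
    have "v + set_mon B \<in> Poly_Mapping.keys (f * mon (set_mon B))"
      using v by (simp add: in_keys_iff lookup_mult_mon)
    then show "v + set_mon B \<in> borel_mons n U (Suc k)" using colon[OF B] by blast
  qed
qed

section \<open>The Borel generator\<close>

lemma min_mon_gens_eq:
  assumes "is_min_mon_gens n I G"
  shows "min_mon_gens n I = G"
proof -
  have "monomial_ideal n I" using assms by (auto simp: is_min_mon_gens_def monomial_ideal_def)
  then show ?thesis
    unfolding min_mon_gens_def by (rule the1_equality[OF ex1_min_mon_gens assms])
qed

lemma is_min_mon_gens_min_mon_gens:
  assumes "monomial_ideal n I"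
  shows "is_min_mon_gens n I (min_mon_gens n I)"
  unfolding min_mon_gens_def using ex1_min_mon_gens[OF assms] by (rule theI')

text \<open>Among monomials of equal degree none properly divides another, so no generator is
  redundant.\<close>

lemma is_min_mon_gens_equigenerated:
  assumes G: "G \<subseteq> monomials n" and d: "\<And>u. u \<in> G \<Longrightarrow> mon_deg u = d"
  shows "is_min_mon_gens n (Idl\<^bsub>poly_ring n\<^esub> (mon ` G :: ((nat \<Rightarrow>\<^sub>0 nat) \<Rightarrow>\<^sub>0 'k::field) set)) G"
  unfolding is_min_mon_gens_def
proof (intro conjI allI impI)
  fix H assume H: "H \<subset> G"
  then obtain u where u: "u \<in> G" "u \<notin> H" by blast
  have Hm: "H \<subseteq> monomials n" and um: "u \<in> monomials n" using H G u by auto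
  have "mon u \<in> Idl\<^bsub>poly_ring n\<^esub> (mon ` G :: ((nat \<Rightarrow>\<^sub>0 nat) \<Rightarrow>\<^sub>0 'k) set)"
    unfolding mon_in_Idl_mon_iff[OF G um]
    using u monomials_0 by (intro bexI[of _ u] bexI[of _ 0]) auto
  moreover have "mon u \<notin> Idl\<^bsub>poly_ring n\<^esub> (mon ` H :: ((nat \<Rightarrow>\<^sub>0 nat) \<Rightarrow>\<^sub>0 'k) set)"
  proof
    assume "mon u \<in> Idl\<^bsub>poly_ring n\<^esub> (mon ` H :: ((nat \<Rightarrow>\<^sub>0 nat) \<Rightarrow>\<^sub>0 'k) set)"
    then obtain g s where g: "g \<in> H" "s \<in> monomials n" "u = s + g"
      unfolding mon_in_Idl_mon_iff[OF Hm um] by blast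
    then have "mon_deg u = mon_deg s + mon_deg g" using mon_deg_add Hm by blast
    moreover have "mon_deg u = mon_deg g" using d u g H by auto
    ultimately have "s = 0" using mon_deg_pos[of s] by auto
    then show False using g u by simp
  qed
  ultimately show "Idl\<^bsub>poly_ring n\<^esub> (mon ` G :: ((nat \<Rightarrow>\<^sub>0 nat) \<Rightarrow>\<^sub>0 'k) set) \<noteq> Idl\<^bsub>poly_ring n\<^esub> (mon ` H)"
    by blast
qed (use G in simp_all)

section \<open>Exchange moves on index sets\<close>

lemma card_exchange:
  assumes "finite S" "j \<in> S" "i \<notin> S"
  shows "card (insert i (S - {j})) = card S"
  using assms card.remove[of S j] by simp

text \<open>Since \<open>i < j\<close>, every initial segment that loses \<open>j\<close> also gains
  \<open>i\<close>, so no count drops.\<close>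

lemma borel_sets_exchange:
  assumes B: "B \<in> borel_sets n U" and ij: "1 \<le> i" "i < j" "j \<le> n" "j \<in> B" "i \<notin> B"
  shows "insert i (B - {j}) \<in> borel_sets n U"
proof -
  have fB: "finite B" using B by (auto simp: borel_sets_def intro: finite_subset)
  have "card (B \<inter> {..<s}) \<le> card (insert i (B - {j}) \<inter> {..<s})" for s
  proof (cases "j < s")
    case True
    then have "insert i (B - {j}) \<inter> {..<s} = insert i ((B \<inter> {..<s}) - {j})" using ij by auto
    moreover have "card (insert i ((B \<inter> {..<s}) - {j})) = card (B \<inter> {..<s})"
      using fB ij True by (intro card_exchange) auto
    ultimately show ?thesis by simp
  next
    case False
    then show ?thesis using fB by (intro card_mono) auto
  qed
  moreover have "card (insert i (B - {j})) = card B"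
    using fB ij by (intro card_exchange) auto
  ultimately show ?thesis
    using B ij by (auto simp: borel_sets_def intro: le_trans)
qed

text \<open>Move the least element of \<open>U - B\<close> down to the least element of \<open>B - U\<close>.\<close>

lemma borel_sets_subset:
  assumes closed: "\<And>V i j. V \<in> \<G> \<Longrightarrow> 1 \<le> i \<Longrightarrow> i < j \<Longrightarrow> j \<le> n \<Longrightarrow> j \<in> V \<Longrightarrow> i \<notin> V \<Longrightarrow>
      insert i (V - {j}) \<in> \<G>"
    and U: "U \<in> \<G>" "U \<subseteq> {1..n}" and B: "B \<in> borel_sets n U"
  shows "B \<in> \<G>"
  using U B
proof (induction "card (U - B)" arbitrary: U rule: less_induct)
  case less
  have fU: "finite U" using less.prems(2) by (rule finite_subset) simp
  have Bn: "B \<subseteq> {1..n}" and cB: "card B = card U"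
    and le: "\<And>s. card (U \<inter> {..<s}) \<le> card (B \<inter> {..<s})"
    using less.prems(3) by (auto simp: borel_sets_def)
  have fB: "finite B" using Bn by (rule finite_subset) simp
  show ?case
  proof (cases "U = B")
    case True
    then show ?thesis using less.prems by simp
  next
    case False
    then have ne: "U - B \<noteq> {}" "B - U \<noteq> {}"
      using fU fB cB card_subset_eq[of B U] card_subset_eq[of U B] by auto
    define i where "i = Min (B - U)"
    define j where "j = Min (U - B)"
    have i: "i \<in> B" "i \<notin> U" "\<And>x. x \<in> B - U \<Longrightarrow> i \<le> x"
      using Min_in[of "B - U"] ne fB by (auto simp: i_def)
    have j: "j \<in> U" "j \<notin> B" "\<And>x. x \<in> U - B \<Longrightarrow> j \<le> x"
      using Min_in[of "U - B"] ne fU by (auto simp: j_def)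
    \<comment> \<open>If \<open>j < i\<close>, every element of \<open>B\<close> up to
      \<open>j\<close> lies in \<open>U\<close>, while \<open>j\<close> lies in \<open>U\<close>
      only; this contradicts \<open>le\<close> at \<open>Suc j\<close>.\<close>
    have ij: "i < j"
    proof (rule ccontr)
      assume "\<not> i < j"
      then have "j < i" using i j by (metis linorder_neqE_nat)
      then have "B \<inter> {..<Suc j} \<subset> U \<inter> {..<Suc j}" using i(3) j(1,2) by force
      then have "card (B \<inter> {..<Suc j}) < card (U \<inter> {..<Suc j})"
        using fU by (intro psubset_card_mono) auto
      then show False using le[of "Suc j"] by simp
    qed
    let ?V = "insert i (U - {j})"
    have i1: "1 \<le> i" "i \<le> n" and jn: "j \<le> n" using i j Bn less.prems(2) by auto
    have "?V - B = (U - B) - {j}" using i by auto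
    then have "card (?V - B) < card (U - B)"
      using j fU card_Diff1_less[of "U - B" j] by auto
    moreover have "?V \<in> \<G>" using closed less.prems(1) i1 ij jn i j by blast
    moreover have "?V \<subseteq> {1..n}" using less.prems(2) i1 by auto
    \<comment> \<open>Segments containing \<open>j\<close> keep their counts under the move. Below
      \<open>j\<close>, every element of \<open>?V\<close> already lies in \<open>B\<close> by the
      minimality of \<open>j\<close>.\<close>
    moreover have "B \<in> borel_sets n ?V"
    proof -
      have "card (?V \<inter> {..<s}) \<le> card (B \<inter> {..<s})" for s
      proof (cases "j < s")
        case True
        then have "?V \<inter> {..<s} = insert i ((U \<inter> {..<s}) - {j})" using ij by auto
        moreover have "card (insert i ((U \<inter> {..<s}) - {j})) = card (U \<inter> {..<s})"
          using fU i j True by (intro card_exchange) auto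
        ultimately show ?thesis using le[of s] by simp
      next
        case False
        then have "?V \<inter> {..<s} \<subseteq> B \<inter> {..<s}" using j(3) i(1) by force
        then show ?thesis using fB by (intro card_mono) auto
      qed
      moreover have "card ?V = card U" using fU i j by (intro card_exchange) auto
      ultimately show ?thesis using Bn cB by (simp add: borel_sets_def)
    qed
    ultimately show ?thesis by (rule less.hyps)
  qed
qed

lemma finite_borel_sets: "finite (borel_sets n U)"
  by (rule finite_subset[of _ "Pow {1..n}"]) (auto simp: borel_sets_def)

text \<open>This makes the explicit ideal a competitor in the minimality condition that defines
  principal ideals.\<close>

lemma squarefree_strongly_stable_borel:
  assumes U: "U \<subseteq> {1..n}"
  shows "squarefree_strongly_stable n
    (Idl\<^bsub>poly_ring n\<^esub> (mon ` set_mon ` borel_sets n U) :: ((nat \<Rightarrow>\<^sub>0 nat) \<Rightarrow>\<^sub>0 'k::field) set)"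
    (is "squarefree_strongly_stable n ?J")
proof -
  let ?G = "set_mon ` borel_sets n U"
  have fin: "finite B" if "B \<in> borel_sets n U" for B
    using that by (auto simp: borel_sets_def intro: finite_subset)
  have Gm: "?G \<subseteq> monomials n"
    using set_mon_borel_mons borel_mons_monomials by blast
  have deg: "mon_deg u = card U" if "u \<in> ?G" for u
    using that by (auto simp: mon_deg_set_mon fin) (simp add: borel_sets_def)
  have G: "min_mon_gens n ?J = ?G"
    by (rule min_mon_gens_eq[OF is_min_mon_gens_equigenerated[OF Gm deg]])
  have "var i + (u - var j) \<in> ?G"
    if "u \<in> ?G" "1 \<le> i" "i < j" "j \<le> n" "j \<in> Poly_Mapping.keys u" "i \<notin> Poly_Mapping.keys u" for u i j
  proof -
    from that(1) obtain B where B: "B \<in> borel_sets n U" "u = set_mon B" by blast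
    then have "j \<in> B" "i \<notin> B" using that fin keys_set_mon by blast+
    then show ?thesis
      using B that fin set_mon_exchange borel_sets_exchange by auto
  qed
  then show ?thesis
    unfolding squarefree_strongly_stable_def G monomial_ideal_def
    using Gm deg fin squarefree_mon_set_mon by blast
qed

text \<open>Minimality of \<open>I\<close> gives one inclusion. For the other, exchange moves lead
  from the Borel generator to every Borel set without leaving
  \<open>min_mon_gens n I\<close>.\<close>

lemma squarefree_strongly_stable_principal_eq:
  fixes I :: "((nat \<Rightarrow>\<^sub>0 nat) \<Rightarrow>\<^sub>0 'k::field) set"
  assumes "squarefree_strongly_stable_principal n I"
  obtains U where "U \<subseteq> {1..n}" "I = Idl\<^bsub>poly_ring n\<^esub> (mon ` set_mon ` borel_sets n U)"
proof -
  let ?G = "min_mon_gens n I"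
  from assms obtain u where sss: "squarefree_strongly_stable n I" and u: "u \<in> ?G" "squarefree_mon u"
    and least: "\<And>J. squarefree_strongly_stable n J \<Longrightarrow> mon u \<in> J \<Longrightarrow> I \<subseteq> J"
    unfolding squarefree_strongly_stable_principal_def by blast
  define U where "U = Poly_Mapping.keys u"
  have uU: "u = set_mon U" using set_mon_keys[OF u(2)] by (simp add: U_def)
  have "is_min_mon_gens n I ?G"
    using sss is_min_mon_gens_min_mon_gens by (auto simp: squarefree_strongly_stable_def)
  then have Gm: "?G \<subseteq> monomials n" and I: "I = Idl\<^bsub>poly_ring n\<^esub> (mon ` ?G)"
    by (auto simp: is_min_mon_gens_def)
  have U: "U \<subseteq> {1..n}" using u(1) Gm by (auto simp: U_def monomials_def)
  let ?J = "Idl\<^bsub>poly_ring n\<^esub> (mon ` set_mon ` borel_sets n U) :: ((nat \<Rightarrow>\<^sub>0 nat) \<Rightarrow>\<^sub>0 'k) set"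
  have UB: "U \<in> borel_sets n U" using U by (simp add: borel_sets_def)
  have "set_mon U \<in> borel_mons n U 1" by (rule set_mon_borel_mons[OF UB])
  then have "mon u \<in> ?J" unfolding Idl_borel_sets[OF U] by (simp add: uU mon_def)
  then have "I \<subseteq> ?J" by (rule least[OF squarefree_strongly_stable_borel[OF U]])
  moreover have "?J \<subseteq> I"
  proof -
    \<comment> \<open>The bound on \<open>V\<close> keeps it finite, so that
      \<open>set_mon V\<close> determines \<open>V\<close>.\<close>
    let ?\<G> = "{V. V \<subseteq> {1..n} \<and> set_mon V \<in> ?G}"
    have "B \<in> ?\<G>" if B: "B \<in> borel_sets n U" for B
    proof (rule borel_sets_subset[OF _ _ U B])
      show "U \<in> ?\<G>" using u U uU by simp
      fix V i j assume V: "V \<in> ?\<G>" and ij: "1 \<le> i" "i < j" "j \<le> n" "j \<in> V" "i \<notin> V"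
      from V have fV: "finite V" by (auto intro: finite_subset)
      then have "var i + (set_mon V - var j) \<in> ?G"
        using V ij sss by (simp add: squarefree_strongly_stable_def keys_set_mon)
      then show "insert i (V - {j}) \<in> ?\<G>"
        unfolding set_mon_exchange[OF fV ij(4,5)] using V ij by auto
    qed
    then have "set_mon ` borel_sets n U \<subseteq> ?G" by blast
    then have "?J \<subseteq> Idl\<^bsub>poly_ring n\<^esub> (mon ` ?G)" unfolding genideal_def by blast
    then show ?thesis unfolding I[symmetric] .
  qed
  ultimately show thesis using that U by blast
qed

theorem corollary1p3:
  fixes n k :: nat
    and I P :: "((nat \<Rightarrow>\<^sub>0 nat) \<Rightarrow>\<^sub>0 'k::field) set"
  assumes "squarefree_strongly_stable_principal n I"
    and "primeideal P (poly_ring n)"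
    and "k \<ge> 1"
    and "P \<in> Ass (poly_ring n) (ideal_power (poly_ring n) I k)"
  shows "P \<in> Ass (poly_ring n) (ideal_power (poly_ring n) I (k + 1))"
proof -
  from assms(1) obtain U where U: "U \<subseteq> {1..n}"
    and I: "I = Idl\<^bsub>poly_ring n\<^esub> (mon ` set_mon ` borel_sets n U)"
    by (rule squarefree_strongly_stable_principal_eq)
  let ?X = "\<lambda>l. {p :: (nat \<Rightarrow>\<^sub>0 nat) \<Rightarrow>\<^sub>0 'k. Poly_Mapping.keys p \<subseteq> borel_mons n U l}"
  let ?F = "mon ` set_mon ` borel_sets n U :: ((nat \<Rightarrow>\<^sub>0 nat) \<Rightarrow>\<^sub>0 'k) set"
  have pow: "ideal_power (poly_ring n) I l = ?X l" for l
    unfolding I Idl_borel_sets[OF U] by (rule ideal_power_borel)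
  have id: "ideal (?X l) (poly_ring n)" for l
    unfolding Idl_borel_mons[symmetric] by (rule ideal_Idl_mon[OF borel_mons_monomials])
  \<comment> \<open>With \<open>?F\<close> as the set of generators of \<open>I\<close>, the colon
    condition reads \<open>I^(k+1) : I = I^k\<close>.\<close>
  have "P \<in> Ass (poly_ring n) (?X (k + 1))"
  proof (rule Ass_persistence_of_colon[OF cring_poly_ring id id])
    show "finite ?F" by (intro finite_imageI finite_borel_sets)
    show "?F \<subseteq> carrier (poly_ring n)"
      using set_mon_borel_mons borel_mons_monomials by (fastforce simp: poly_ring_def mon_def)
    show "P \<in> Ass (poly_ring n) (?X k)" using assms(4) by (simp add: pow)
    fix f :: "(nat \<Rightarrow>\<^sub>0 nat) \<Rightarrow>\<^sub>0 'k"
    show "f \<otimes>\<^bsub>poly_ring n\<^esub> g \<in> ?X (k + 1)" if f: "f \<in> ?X k" and g: "g \<in> ?F" for g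
    proof -
      from g obtain B where B: "B \<in> borel_sets n U" "g = mon (set_mon B)" by blast
      have "Poly_Mapping.keys (f * g) \<subseteq> borel_mons n U (k + 1)"
        using keys_mult[of f g] f borel_mons_add[of _ n U k "set_mon B" 1] set_mon_borel_mons[OF B(1)]
        by (force simp: B(2) mon_def)
      then show ?thesis by (simp add: poly_ring_def)
    qed
    show "f \<in> ?X k" if "f \<in> carrier (poly_ring n)"
      and colon: "\<And>g. g \<in> ?F \<Longrightarrow> f \<otimes>\<^bsub>poly_ring n\<^esub> g \<in> ?X (k + 1)"
    proof -
      have "Poly_Mapping.keys f \<subseteq> borel_mons n U k"
      proof (rule borel_colon[OF U])
        show "Poly_Mapping.keys f \<subseteq> monomials n" using that(1) by (simp add: poly_ring_def)
        fix B assume "B \<in> borel_sets n U"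
        then show "Poly_Mapping.keys (f * mon (set_mon B)) \<subseteq> borel_mons n U (Suc k)"
          using colon[of "mon (set_mon B)"] by (simp add: poly_ring_def)
      qed
      then show ?thesis by simp
    qed
  qed
  then show ?thesis by (simp add: pow)
qed

end
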